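(* Let $M$ be a complete pointed metric space. The extreme points of $B_{\mathcal{F}(M)}^+$ are precisely the normalized evaluation functionals, i.e. $0$ and $\delta(x)/d(x,0)$ for $x\in M\setminus\{0\}$. Moreover, all of them are preserved extreme points of $B_{\mathcal{F}(M)}^+$.
   Context: A pointed metric space $(M,d)$ has a distinguished base point $0\in M$. $\mathrm{Lip}_0(M)$ is the Banach space of all real-valued Lipschitz functions $f$ on $M$ with $f(0)=0$, normed by the Lipschitz constant $\|f\|_L$. For $x\in M$, $\delta(x)\in\mathrm{Lip}_0(M)^*$ is the evaluation functional $f\mapsto f(x)$. The Lipschitz-free space is $\mathcal{F}(M)=\overline{\mathrm{span}}\,\{\delta(x):x\in M\}\subset \mathrm{Lip}_0(M)^*$ (norm closure); its dual is canonically $\mathrm{Lip}_0(M)$, so its bidual is $\mathrm{Lip}_0(M)^*$. An element $\phi$ of $\mathcal{F}(M)$ (or $\mathrm{Lip}_0(M)^*$) is positive, written $\phi\ge 0$, if $\phi(f)\ge 0$ for every $f\in\mathrm{Lip}_0(M)$ with $f\ge 0$ pointwise. $B_{\mathcal{F}(M)}^+$ is the set of positive elements of the closed unit ball of $\mathcal{F}(M)$. For a convex subset $C$ of a Banach space $X$ and $x\in C$: $x$ is an extreme point of $C$ if it cannot be written as $x=\frac12(y+z)$ with $y,z\in C\setminus\{x\}$; $x$ is a preserved extreme point of $C$ if it is an extreme point of the weak$^*$ closure $\overline{C}^{w^*}$ of $C$ in $X^{**}$. *)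

theory Defs
  imports "HOL-Analysis.Analysis"
begin

text \<open>
  A pointed metric space is a type of sort \<open>{metric_space, zero}\<close>. The class \<open>zero\<close> is purely
  syntactic (it has no axioms), so \<open>0\<close> is an arbitrary distinguished point of the space.
\<close>

typedef (overloaded) ('a :: "{metric_space, zero}") lip0 =
  "{f :: 'a \<Rightarrow> real. (\<exists>C. C-lipschitz_on UNIV f) \<and> f 0 = 0}"
  morphisms lip0_apply Lip0
  by (rule exI[of _ "\<lambda>_. 0"]) (auto intro!: exI[of _ 0] simp: lipschitz_on_def)

setup_lifting type_definition_lip0

text \<open>
  An infimum rather than a supremum of difference quotients, since on a one-point space the latter
  would range over the empty set. Note that \<open>C-lipschitz_on\<close> includes \<open>0 \<le> C\<close>.
\<close>

definition lipschitz_constant :: "('a :: metric_space \<Rightarrow> real) \<Rightarrow> real"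
  where "lipschitz_constant f = Inf {C. C-lipschitz_on UNIV f}"

lemma lipschitz_constant_le: "C-lipschitz_on UNIV f \<Longrightarrow> lipschitz_constant f \<le> C"
  unfolding lipschitz_constant_def
  by (rule cInf_lower) (auto intro: bdd_belowI[of _ 0] lipschitz_on_nonneg)

lemma lipschitz_constant_lipschitz:
  assumes "C-lipschitz_on UNIV f"
  shows "(lipschitz_constant f)-lipschitz_on UNIV f"
proof (rule lipschitz_onI)
  have ne: "{C. C-lipschitz_on UNIV f} \<noteq> {}"
    using assms by blast
  show "0 \<le> lipschitz_constant f"
    unfolding lipschitz_constant_def
    by (rule cInf_greatest[OF ne]) (auto intro: lipschitz_on_nonneg)
  fix x y :: 'a
  show "dist (f x) (f y) \<le> lipschitz_constant f * dist x y"
  proof (cases "x = y")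
    case False
    have "dist (f x) (f y) / dist x y \<le> lipschitz_constant f"
      unfolding lipschitz_constant_def
      by (rule cInf_greatest[OF ne]) (use False in \<open>auto simp: lipschitz_on_def field_simps\<close>)
    then show ?thesis
      using False by (simp add: field_simps)
  qed simp
qed

lemma lipschitz_constant_scale_le:
  fixes f :: "'a :: metric_space \<Rightarrow> real"
  assumes "C-lipschitz_on UNIV f"
  shows "lipschitz_constant (\<lambda>x. r * f x) \<le> \<bar>r\<bar> * lipschitz_constant f"
  by (rule lipschitz_constant_le[OF lipschitz_on_cmult_real[OF lipschitz_constant_lipschitz[OF assms]]])

lemma lipschitz_constant_scale:
  fixes f :: "'a :: metric_space \<Rightarrow> real"
  assumes C: "C-lipschitz_on UNIV f"
  shows "lipschitz_constant (\<lambda>x. r * f x) = \<bar>r\<bar> * lipschitz_constant f"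
proof (cases "r = 0")
  case True
  have "0-lipschitz_on UNIV (\<lambda>x::'a. 0::real)"
    by (simp add: lipschitz_on_def)
  from lipschitz_constant_le[OF this] lipschitz_on_nonneg[OF lipschitz_constant_lipschitz[OF this]]
  show ?thesis
    using True by simp
next
  case False
  have "lipschitz_constant f \<le> \<bar>inverse r\<bar> * lipschitz_constant (\<lambda>x. r * f x)"
    using lipschitz_constant_scale_le[OF lipschitz_on_cmult_real[OF C, of r], of "inverse r"] False
    by (simp add: mult.assoc[symmetric])
  then have "\<bar>r\<bar> * lipschitz_constant f \<le> lipschitz_constant (\<lambda>x. r * f x)"
    using False by (simp add: field_simps abs_inverse)
  then show ?thesis
    using lipschitz_constant_scale_le[OF C, of r] by linarith
qed

lemma lipschitz_constant_eq_0_iff: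
  fixes f :: "'a :: {metric_space, zero} \<Rightarrow> real"
  assumes "C-lipschitz_on UNIV f" "f 0 = 0"
  shows "lipschitz_constant f = 0 \<longleftrightarrow> f = (\<lambda>_. 0)"
proof
  note L = lipschitz_constant_lipschitz[OF assms(1)]
  show "f = (\<lambda>_. 0)" if "lipschitz_constant f = 0"
  proof
    show "f x = 0" for x
      using lipschitz_onD[OF L, of x 0] that assms(2) by simp
  qed
  show "lipschitz_constant f = 0" if "f = (\<lambda>_. 0)"
  proof -
    have "0-lipschitz_on UNIV f"
      by (simp add: that lipschitz_on_def)
    from lipschitz_constant_le[OF this] lipschitz_on_nonneg[OF L]
    show ?thesis by simp
  qed
qed

instantiation lip0 :: ("{metric_space, zero}") real_normed_vector
begin

lift_definition norm_lip0 :: "'a lip0 \<Rightarrow> real" is lipschitz_constant .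

lift_definition zero_lip0 :: "'a lip0" is "\<lambda>_. 0"
  by (auto intro!: exI[of _ 0] simp: lipschitz_on_def)

lift_definition plus_lip0 :: "'a lip0 \<Rightarrow> 'a lip0 \<Rightarrow> 'a lip0" is "\<lambda>f g x. f x + g x"
  by (auto intro: lipschitz_on_add)

lift_definition uminus_lip0 :: "'a lip0 \<Rightarrow> 'a lip0" is "\<lambda>f x. - f x"
  by (auto intro: lipschitz_on_minus)

lift_definition minus_lip0 :: "'a lip0 \<Rightarrow> 'a lip0 \<Rightarrow> 'a lip0" is "\<lambda>f g x. f x - g x"
  by (auto intro: lipschitz_on_diff)

lift_definition scaleR_lip0 :: "real \<Rightarrow> 'a lip0 \<Rightarrow> 'a lip0" is "\<lambda>r f x. r * f x"
  by (auto intro: lipschitz_on_cmult_real)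

definition dist_lip0 :: "'a lip0 \<Rightarrow> 'a lip0 \<Rightarrow> real"
  where "dist_lip0 f g = norm (f - g)"

definition sgn_lip0 :: "'a lip0 \<Rightarrow> 'a lip0"
  where "sgn_lip0 f = scaleR (inverse (norm f)) f"

definition uniformity_lip0 :: "('a lip0 \<times> 'a lip0) filter"
  where "uniformity_lip0 = (INF e\<in>{0 <..}. principal {(f, g). dist f g < e})"

definition open_lip0 :: "'a lip0 set \<Rightarrow> bool"
  where "open_lip0 S = (\<forall>f\<in>S. \<forall>\<^sub>F (f', g) in uniformity. f' = f \<longrightarrow> g \<in> S)"

instance
proof
  fix f g :: "'a lip0" and r :: real
  show "norm f = 0 \<longleftrightarrow> f = 0"
    by transfer (auto simp: lipschitz_constant_eq_0_iff)
  show "norm (f + g) \<le> norm f + norm g"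
    by transfer (auto intro!: lipschitz_constant_le lipschitz_on_add intro: lipschitz_constant_lipschitz)
  show "norm (r *\<^sub>R f) = \<bar>r\<bar> * norm f"
    by transfer (auto intro: lipschitz_constant_scale)
  show "dist f g = norm (f - g)" by (rule dist_lip0_def)
  show "sgn f = inverse (norm f) *\<^sub>R f" by (rule sgn_lip0_def)
  show "(uniformity :: ('a lip0 \<times> 'a lip0) filter) = (INF e\<in>{0 <..}. principal {(f, g). dist f g < e})"
    by (rule uniformity_lip0_def)
  show "open S \<longleftrightarrow> (\<forall>f\<in>S. \<forall>\<^sub>F (f', g) in uniformity. f' = f \<longrightarrow> g \<in> S)" for S :: "'a lip0 set"
    by (rule open_lip0_def)
qed (transfer, simp add: algebra_simps)+

end

lemma lip0_apply_zero_point: "lip0_apply f 0 = 0"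
  using lip0_apply[of f] by simp

lemma lip0_apply_lipschitz: "(norm f)-lipschitz_on UNIV (lip0_apply f)"
  by transfer (auto intro: lipschitz_constant_lipschitz)

lemma abs_lip0_apply_le: "\<bar>lip0_apply f x\<bar> \<le> norm f * dist x 0"
  using lipschitz_onD[OF lip0_apply_lipschitz, of x 0 f] by (simp add: lip0_apply_zero_point)

lift_definition evaluation :: "'a :: {metric_space, zero} \<Rightarrow> 'a lip0 \<Rightarrow>\<^sub>L real"
  is "\<lambda>x f. lip0_apply f x"
proof (rule bounded_linear_intro)
  fix x :: 'a and f g :: "'a lip0" and r :: real
  show "lip0_apply (f + g) x = lip0_apply f x + lip0_apply g x" by transfer simp
  show "lip0_apply (r *\<^sub>R f) x = r *\<^sub>R lip0_apply f x" by transfer simp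
  show "norm (lip0_apply f x) \<le> norm f * dist x 0" by (simp add: abs_lip0_apply_le)
qed

typedef (overloaded) ('a :: "{metric_space, zero}") lipfree =
  "closure (span (range (evaluation :: 'a \<Rightarrow> 'a lip0 \<Rightarrow>\<^sub>L real)))"
  morphisms functional_of Lipfree
  by (rule exI[of _ 0], rule subsetD[OF closure_subset span_zero])

setup_lifting type_definition_lipfree

lemma subspace_lipfree: "subspace (closure (span (range evaluation)))"
proof (rule subspaceI)
  show "0 \<in> closure (span (range evaluation))"
    by (rule subsetD[OF closure_subset span_zero])
next
  fix \<phi> \<psi> :: "'a lip0 \<Rightarrow>\<^sub>L real"
  assume "\<phi> \<in> closure (span (range evaluation))" "\<psi> \<in> closure (span (range evaluation))"
  then obtain u v where "\<forall>n. u n \<in> span (range evaluation)" "u \<longlonglongrightarrow> \<phi>"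
      "\<forall>n. v n \<in> span (range evaluation)" "v \<longlonglongrightarrow> \<psi>"
    unfolding closure_sequential by blast
  then show "\<phi> + \<psi> \<in> closure (span (range evaluation))"
    unfolding closure_sequential
    by (intro exI[of _ "\<lambda>n. u n + v n"]) (simp add: span_add tendsto_add)
next
  fix r :: real and \<phi> :: "'a lip0 \<Rightarrow>\<^sub>L real"
  assume "\<phi> \<in> closure (span (range evaluation))"
  then obtain u where "\<forall>n. u n \<in> span (range evaluation)" "u \<longlonglongrightarrow> \<phi>"
    unfolding closure_sequential by blast
  then show "r *\<^sub>R \<phi> \<in> closure (span (range evaluation))"
    unfolding closure_sequential
    by (intro exI[of _ "\<lambda>n. r *\<^sub>R u n"]) (simp add: span_scale tendsto_scaleR)
qed

text \<open>The free space carries the linear structure and the norm of the dual of \<open>'a lip0\<close>.\<close>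

instantiation lipfree :: ("{metric_space, zero}") real_normed_vector
begin

lift_definition norm_lipfree :: "'a lipfree \<Rightarrow> real" is norm .

lift_definition zero_lipfree :: "'a lipfree" is 0
  by (rule subspace_0[OF subspace_lipfree])

lift_definition plus_lipfree :: "'a lipfree \<Rightarrow> 'a lipfree \<Rightarrow> 'a lipfree" is "(+)"
  by (rule subspace_add[OF subspace_lipfree])

lift_definition uminus_lipfree :: "'a lipfree \<Rightarrow> 'a lipfree" is uminus
  by (rule subspace_neg[OF subspace_lipfree])

lift_definition minus_lipfree :: "'a lipfree \<Rightarrow> 'a lipfree \<Rightarrow> 'a lipfree" is "(-)"
  by (rule subspace_diff[OF subspace_lipfree])

lift_definition scaleR_lipfree :: "real \<Rightarrow> 'a lipfree \<Rightarrow> 'a lipfree" is "(*\<^sub>R)"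
  by (rule subspace_scale[OF subspace_lipfree])

definition dist_lipfree :: "'a lipfree \<Rightarrow> 'a lipfree \<Rightarrow> real"
  where "dist_lipfree m n = norm (m - n)"

definition sgn_lipfree :: "'a lipfree \<Rightarrow> 'a lipfree"
  where "sgn_lipfree m = scaleR (inverse (norm m)) m"

definition uniformity_lipfree :: "('a lipfree \<times> 'a lipfree) filter"
  where "uniformity_lipfree = (INF e\<in>{0 <..}. principal {(m, n). dist m n < e})"

definition open_lipfree :: "'a lipfree set \<Rightarrow> bool"
  where "open_lipfree S = (\<forall>m\<in>S. \<forall>\<^sub>F (m', n) in uniformity. m' = m \<longrightarrow> n \<in> S)"

instance
  apply standard
  unfolding dist_lipfree_def sgn_lipfree_def uniformity_lipfree_def open_lipfree_def
  apply (rule refl | (transfer, force simp: algebra_simps norm_triangle_ineq))+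
  done

end

lift_definition delta :: "'a :: {metric_space, zero} \<Rightarrow> 'a lipfree" is evaluation
  by (rule subsetD[OF closure_subset span_base[OF rangeI]])

definition positive_functional :: "('a :: {metric_space, zero} lip0 \<Rightarrow>\<^sub>L real) \<Rightarrow> bool"
  where "positive_functional \<phi> \<longleftrightarrow> (\<forall>f. (\<forall>x. 0 \<le> lip0_apply f x) \<longrightarrow> 0 \<le> blinfun_apply \<phi> f)"

definition positive_unit_ball :: "'a :: {metric_space, zero} lipfree set"
  where "positive_unit_ball = {m \<in> cball 0 1. positive_functional (functional_of m)}"

lift_definition bidual_embedding ::
  "'b :: real_normed_vector \<Rightarrow> (('b \<Rightarrow>\<^sub>L real) \<Rightarrow>\<^sub>L real)" is "\<lambda>x f. blinfun_apply f x"
  by (rule blinfun.bounded_linear_left)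

text \<open>
  On functionals, the strong operator topology is the topology of pointwise convergence, so on
  \<open>('b \<Rightarrow>\<^sub>L real) \<Rightarrow>\<^sub>L real\<close> it is the weak* topology of the bidual. The notion is meant for convex
  \<open>C\<close>; then \<open>C\<close> and its weak* closure are convex, so that \<open>extreme_point_of\<close> (no proper convex
  combinations) amounts to the condition on midpoints.
\<close>

definition preserved_extreme_point_of :: "'b :: real_normed_vector \<Rightarrow> 'b set \<Rightarrow> bool"
    (infixr \<open>(preserved'_extreme'_point'_of)\<close> 50)
  where "x preserved_extreme_point_of C \<longleftrightarrow>
    bidual_embedding x extreme_point_of (strong_operator_topology closure_of (bidual_embedding ` C))"

end

theory Submission
  imports Defs
begin

text \<open>
  Write \<open>\<rho> = d(\<cdot>,0)\<close>. Since \<open>|f| \<le> \<parallel>f\<parallel> \<rho>\<close>, a positive functional \<open>\<phi>\<close> has norm \<open>\<phi>(\<rho>)\<close>, so the norm is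
  additive on the positive cone. If a convex combination of positive bidual elements of norm at
  most 1 equals \<open>\<delta>(x)/\<rho>(x)\<close>, then each of them takes the value 1 at \<open>\<rho>\<close> and vanishes at
  \<open>|f - f(x)/\<rho>(x) \<rho>|\<close>, which determines it on \<open>f\<close>.

  Conversely, let \<open>m \<noteq> 0\<close> be extreme. The product \<open>u f / \<rho>\<close> turns the Lipschitz functions vanishing at
  the base point into an algebra with unit \<open>\<rho>\<close>, and multiplication by \<open>u\<close> is adjoint to an operator on
  the free space. For \<open>0 \<le> u \<le> \<rho>\<close> this splits \<open>m\<close> into two positive parts whose norms sum to 1, so
  extremality makes \<open>m\<close> multiplicative. Hence \<open>m(min f g)\<close> is one of \<open>m(f)\<close>, \<open>m(g)\<close>. Approximating \<open>m\<close> by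
  a finitely supported element and taking the minimum of the functions
  \<open>q\<^sub>x = min (d(x,\<cdot>)) \<rho>\<close> over its support yields points \<open>x\<^sub>n\<close> with \<open>m(q\<^sub>x\<^sub>n) \<longlonglongrightarrow> 0\<close>. They form a Cauchy
  sequence, because \<open>min t \<rho> \<le> q\<^sub>x + q\<^sub>y\<close> if \<open>t \<le> d(x,y)\<close> and \<open>m(min t \<rho>) > 0\<close> for \<open>t > 0\<close>. The limit \<open>x\<close>
  satisfies \<open>m(q\<^sub>x) = 0\<close>, and \<open>m\<close> vanishes at every \<open>f\<close> with \<open>f(x) = 0\<close>, since then \<open>|f| \<le> \<parallel>f\<parallel> q\<^sub>x\<close>.
\<close>

section \<open>Lattice operations, distance functions and the product of Lipschitz functions\<close>

lift_definition lip0_abs :: "'a :: {metric_space, zero} lip0 \<Rightarrow> 'a lip0" is "\<lambda>f x. \<bar>f x\<bar>"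
  by (force simp: lipschitz_on_def dist_real_def intro: order_trans[OF abs_triangle_ineq3])

lemma lipschitz_on_min:
  fixes f g :: "'a :: metric_space \<Rightarrow> real"
  assumes "C-lipschitz_on S f" "D-lipschitz_on S g"
  shows "(max C D)-lipschitz_on S (\<lambda>x. min (f x) (g x))"
proof (rule lipschitz_onI)
  fix x y assume xy: "x \<in> S" "y \<in> S"
  have "dist (f x) (f y) \<le> max C D * dist x y"
    using lipschitz_onD[OF assms(1) xy] by (rule order_trans) (simp add: mult_right_mono)
  moreover have "dist (g x) (g y) \<le> max C D * dist x y"
    using lipschitz_onD[OF assms(2) xy] by (rule order_trans) (simp add: mult_right_mono)
  ultimately show "dist (min (f x) (g x)) (min (f y) (g y)) \<le> max C D * dist x y"
    by (simp add: dist_real_def min_def abs_le_iff split: if_splits)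
qed (use lipschitz_on_nonneg[OF assms(1)] in simp)

lift_definition lip0_min :: "'a :: {metric_space, zero} lip0 \<Rightarrow> 'a lip0 \<Rightarrow> 'a lip0"
  is "\<lambda>f g x. min (f x) (g x)"
  by (auto intro: lipschitz_on_min)

lemma lipschitz_on_dist_left: "1-lipschitz_on S (dist x)"
proof (rule lipschitz_onI)
  show "dist (dist x y) (dist x z) \<le> 1 * dist y z" for y z
    using abs_dist_diff_le[of y x z] by (simp add: dist_real_def dist_commute)
qed simp

lemma lipschitz_on_dist_right: "1-lipschitz_on S (\<lambda>y. dist y x)"
  using lipschitz_on_dist_left[of S x] by (simp add: dist_commute)

lift_definition base_dist :: "'a :: {metric_space, zero} lip0" is "\<lambda>x. dist x 0"
  using lipschitz_on_dist_right by auto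

text \<open>The cut-off by \<open>dist y 0\<close> forces the value 0 at the base point. The result
  is the largest function of norm at most 1 that vanishes at \<open>x\<close>.\<close>

lift_definition point_dist :: "'a :: {metric_space, zero} \<Rightarrow> 'a lip0"
  is "\<lambda>x y. min (dist x y) (dist y 0)"
  using lipschitz_on_min[OF lipschitz_on_dist_left lipschitz_on_dist_right] by auto

text \<open>The absolute value makes the function vanish at the base point for negative \<open>t\<close> as well.\<close>

lift_definition truncated_dist :: "real \<Rightarrow> 'a :: {metric_space, zero} lip0"
  is "\<lambda>t y. min \<bar>t\<bar> (dist y 0)"
  using lipschitz_on_min[OF lipschitz_on_constant lipschitz_on_dist_right] by auto

text \<open>At the base point the quotient is \<open>0 / 0 = 0\<close>, which is the right value.\<close>

lemma lipschitz_on_product_over_base_dist: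
  fixes f g :: "'a :: {metric_space, zero} \<Rightarrow> real"
  assumes f: "C-lipschitz_on UNIV f" "f 0 = 0" and g: "D-lipschitz_on UNIV g" "g 0 = 0"
  shows "(3 * C * D)-lipschitz_on UNIV (\<lambda>x. f x * g x / dist x 0)"
proof (rule lipschitz_onI)
  have C: "0 \<le> C" and D: "0 \<le> D"
    using f g by (auto intro: lipschitz_on_nonneg)
  then show "0 \<le> 3 * C * D" by simp
  have fb: "\<bar>f x\<bar> \<le> C * dist x 0" and gb: "\<bar>g x\<bar> \<le> D * dist x 0" for x
    using lipschitz_onD[OF f(1), of x 0] lipschitz_onD[OF g(1), of x 0] f g by simp_all
  \<comment> \<open>By symmetry the point farther from the base point may be called
    \<open>x\<close>; this order is what bounds \<open>g y / dist x 0\<close> by \<open>D\<close>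
    below.\<close>
  have *: "\<bar>f x * g x / dist x 0 - f y * g y / dist y 0\<bar> \<le> 3 * C * D * dist x y"
    if le: "dist y 0 \<le> dist x 0" for x y
  proof (cases "x = 0 \<or> y = 0")
    case True
    show ?thesis
    proof (cases "x = 0")
      case True
      with le have "y = 0" by simp
      then show ?thesis using True by simp
    next
      case False
      with True have [simp]: "y = 0" by simp
      have "\<bar>f x * g x\<bar> \<le> (C * dist x 0) * (D * dist x 0)"
        unfolding abs_mult by (rule mult_mono) (use fb gb C in auto)
      also have "\<dots> \<le> (3 * C * D * dist x 0) * dist x 0"
        using C D by (simp add: mult_left_mono)
      finally show ?thesis
        using False by (simp add: abs_mult divide_le_eq f)
    qed
  next
    case False
    define r s where "r = dist x 0" and "s = dist y 0"
    have rs: "0 < s" "s \<le> r" using False le by (auto simp: r_def s_def)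
    have rsd: "\<bar>r - s\<bar> \<le> dist x y"
      unfolding r_def s_def using abs_dist_diff_le[of x 0 y] by (simp add: dist_commute)
    \<comment> \<open>The three terms are the increments in \<open>g\<close>, in \<open>f\<close>
      and in the divisor. Each is at most \<open>C * D * dist x y\<close>, whence the factor
      3.\<close>
    have eq: "f x * g x / r - f y * g y / s
        = f x / r * (g x - g y) + g y / r * (f x - f y) - f y / s * (g y / r) * (r - s)"
      using rs by (simp add: field_simps)
    have a: "\<bar>f x / r\<bar> \<le> C" "\<bar>f y / s\<bar> \<le> C"
      using fb[of x] fb[of y] rs C by (simp_all add: r_def s_def divide_le_eq)
    have "\<bar>g y\<bar> \<le> D * r" using gb[of y] mult_left_mono[OF rs(2) D] by (simp add: s_def)
    then have b: "\<bar>g y / r\<bar> \<le> D" using rs by (simp add: divide_le_eq)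
    have df: "\<bar>f x - f y\<bar> \<le> C * dist x y" and dg: "\<bar>g x - g y\<bar> \<le> D * dist x y"
      using lipschitz_onD[OF f(1), of x y] lipschitz_onD[OF g(1), of x y] by (simp_all add: dist_real_def)
    have "\<bar>f x / r * (g x - g y)\<bar> \<le> C * (D * dist x y)"
      unfolding abs_mult[of "f x / r"] by (rule mult_mono) (use a dg C in auto)
    moreover have "\<bar>g y / r * (f x - f y)\<bar> \<le> D * (C * dist x y)"
      unfolding abs_mult[of "g y / r"] by (rule mult_mono) (use b df D in auto)
    moreover have "\<bar>f y / s * (g y / r) * (r - s)\<bar> \<le> C * D * dist x y"
      unfolding abs_mult[of "f y / s * (g y / r)"] abs_mult[of "f y / s"]
      by (intro mult_mono) (use a b C D rsd in auto)
    ultimately have "\<bar>f x / r * (g x - g y) + g y / r * (f x - f y) - f y / s * (g y / r) * (r - s)\<bar>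
        \<le> C * (D * dist x y) + D * (C * dist x y) + C * D * dist x y"
      using abs_triangle_ineq4 abs_triangle_ineq by (meson add_mono order_trans)
    then show ?thesis
      unfolding r_def[symmetric] s_def[symmetric] eq by (simp add: algebra_simps)
  qed
  fix x y :: 'a
  show "dist (f x * g x / dist x 0) (f y * g y / dist y 0) \<le> 3 * C * D * dist x y"
    using *[of x y] *[of y x] by (cases "dist y 0 \<le> dist x 0") (auto simp: dist_real_def dist_commute)
qed

lift_definition lip0_mult :: "'a :: {metric_space, zero} lip0 \<Rightarrow> 'a lip0 \<Rightarrow> 'a lip0"
  is "\<lambda>f g x. f x * g x / dist x 0"
  by (auto intro: lipschitz_on_product_over_base_dist)

lemma norm_lip0_le: "C-lipschitz_on UNIV (lip0_apply f) \<Longrightarrow> norm f \<le> C"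
  by transfer (rule lipschitz_constant_le)

lemma lip0_eqI: "(\<And>x. lip0_apply f x = lip0_apply g x) \<Longrightarrow> f = g"
  by transfer auto

lemma lip0_apply_simps [simp]:
  "lip0_apply 0 x = 0"
  "lip0_apply (f + g) x = lip0_apply f x + lip0_apply g x"
  "lip0_apply (f - g) x = lip0_apply f x - lip0_apply g x"
  "lip0_apply (- f) x = - lip0_apply f x"
  "lip0_apply (r *\<^sub>R f) x = r * lip0_apply f x"
  "lip0_apply base_dist x = dist x 0"
  "lip0_apply (lip0_abs f) x = \<bar>lip0_apply f x\<bar>"
  "lip0_apply (lip0_min f g) x = min (lip0_apply f x) (lip0_apply g x)"
  "lip0_apply (point_dist y) x = min (dist y x) (dist x 0)"
  "lip0_apply (truncated_dist t) x = min \<bar>t\<bar> (dist x 0)"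
  "lip0_apply (lip0_mult f g) x = lip0_apply f x * lip0_apply g x / dist x 0"
  by (transfer, simp)+

lemma norm_lip0_min_le: "norm (lip0_min f g) \<le> max (norm f) (norm g)"
  by (rule norm_lip0_le) (auto intro: lipschitz_on_min lip0_apply_lipschitz)

lemma norm_base_dist_le: "norm base_dist \<le> 1"
  by (rule norm_lip0_le) (simp add: lipschitz_on_dist_right)

lemma norm_point_dist_le: "norm (point_dist x) \<le> 1"
  by (rule norm_lip0_le)
    (use lipschitz_on_min[OF lipschitz_on_dist_left lipschitz_on_dist_right] in auto)

lemma norm_truncated_dist_le: "norm (truncated_dist t) \<le> 1"
  by (rule norm_lip0_le)
    (use lipschitz_on_min[OF lipschitz_on_constant lipschitz_on_dist_right] in auto)

lemma norm_lip0_mult_le: "norm (lip0_mult f g) \<le> 3 * norm f * norm g"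
  by (rule norm_lip0_le)
    (use lipschitz_on_product_over_base_dist[OF lip0_apply_lipschitz lip0_apply_zero_point
        lip0_apply_lipschitz lip0_apply_zero_point] in auto)

lemma point_dist_zero: "point_dist 0 = base_dist"
  by (rule lip0_eqI) (simp add: dist_commute)

lift_definition lip0_mult_blinfun ::
  "'a :: {metric_space, zero} lip0 \<Rightarrow> 'a lip0 \<Rightarrow>\<^sub>L 'a lip0" is lip0_mult
proof (rule bounded_linear_intro)
  show "norm (lip0_mult f g) \<le> norm g * (3 * norm f)" for f g :: "'a lip0"
    using norm_lip0_mult_le[of f g] by (simp add: mult_ac)
qed (auto intro!: lip0_eqI simp: algebra_simps add_divide_distrib)

section \<open>Positive functionals and the norm on the positive cone\<close>

lemma positive_functional_mono:
  assumes "positive_functional \<phi>" "\<And>x. lip0_apply f x \<le> lip0_apply g x"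
  shows "\<phi> f \<le> \<phi> g"
proof -
  have "0 \<le> \<phi> (g - f)"
    using assms unfolding positive_functional_def by simp
  then show ?thesis by (simp add: blinfun.diff_right)
qed

lemma positive_functional_abs_le:
  assumes "positive_functional \<phi>" "\<And>x. \<bar>lip0_apply f x\<bar> \<le> lip0_apply g x"
  shows "\<bar>\<phi> f\<bar> \<le> \<phi> g"
  using positive_functional_mono[OF assms(1), of f g] positive_functional_mono[OF assms(1), of "- f" g]
    assms(2) by (auto simp: abs_le_iff blinfun.minus_right)

text \<open>\<open>base_dist\<close> has norm at most 1 and dominates every function of norm at most
  1, so a positive functional attains its norm there.\<close>

lemma norm_positive_functional:
  fixes \<phi> :: "'a :: {metric_space, zero} lip0 \<Rightarrow>\<^sub>L real"
  assumes "positive_functional \<phi>"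
  shows "norm \<phi> = \<phi> base_dist"
proof (rule antisym)
  have nonneg: "0 \<le> \<phi> base_dist"
    using assms by (simp add: positive_functional_def)
  show "norm \<phi> \<le> \<phi> base_dist"
  proof (rule norm_blinfun_bound[OF nonneg])
    fix f
    have "\<bar>\<phi> f\<bar> \<le> \<phi> (norm f *\<^sub>R base_dist)"
      by (rule positive_functional_abs_le[OF assms]) (simp add: abs_lip0_apply_le)
    then show "norm (\<phi> f) \<le> \<phi> base_dist * norm f"
      by (simp add: blinfun.scaleR_right mult.commute)
  qed
  have "\<phi> base_dist \<le> norm \<phi> * norm (base_dist :: 'a lip0)"
    using norm_blinfun[of \<phi> base_dist] by simp
  also have "\<dots> \<le> norm \<phi> * 1"
    by (rule mult_left_mono[OF norm_base_dist_le]) simp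
  finally show "\<phi> base_dist \<le> norm \<phi>" by simp
qed

lemma functional_of_simps [simp]:
  "functional_of 0 = 0"
  "functional_of (m + n) = functional_of m + functional_of n"
  "functional_of (m - n) = functional_of m - functional_of n"
  "functional_of (r *\<^sub>R m) = r *\<^sub>R functional_of m"
  "functional_of (delta x) = evaluation x"
  by (simp_all add: zero_lipfree.rep_eq plus_lipfree.rep_eq minus_lipfree.rep_eq
      scaleR_lipfree.rep_eq delta.rep_eq)

lemma evaluation_apply [simp]: "evaluation x f = lip0_apply f x"
  by transfer simp

lemma lipfree_eqI: "(\<And>f. functional_of m f = functional_of n f) \<Longrightarrow> m = n"
  by (meson functional_of_inject blinfun_eqI)

text \<open>On positive elements the norm bound is a linear inequality, which is the form used for
  convex splittings and for weak* limits.\<close>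

lemma mem_positive_unit_ball_iff:
  "m \<in> positive_unit_ball \<longleftrightarrow>
    positive_functional (functional_of m) \<and> functional_of m base_dist \<le> 1"
  using norm_positive_functional[of "functional_of m"]
  by (auto simp: positive_unit_ball_def norm_lipfree.rep_eq)

lemma lipfree_eq_0_iff:
  assumes "positive_functional (functional_of m)"
  shows "m = 0 \<longleftrightarrow> functional_of m base_dist = 0"
  by (metis assms norm_eq_zero norm_lipfree.rep_eq norm_positive_functional)

section \<open>Multiplication operators and bounded pointwise limits on the free space\<close>

text \<open>The adjoint of multiplication by \<open>f\<close> sends each evaluation to a multiple of
  itself, hence preserves their span and, being continuous, its closure.\<close>

lift_definition lipfree_mult :: "'a :: {metric_space, zero} lip0 \<Rightarrow> 'a lipfree \<Rightarrow> 'a lipfree"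
  is "\<lambda>f \<phi>. \<phi> o\<^sub>L lip0_mult_blinfun f"
proof -
  fix f :: "'a lip0" and \<phi> :: "'a lip0 \<Rightarrow>\<^sub>L real"
  let ?V = "span (range (evaluation :: 'a \<Rightarrow> 'a lip0 \<Rightarrow>\<^sub>L real))"
  let ?T = "\<lambda>\<psi> :: 'a lip0 \<Rightarrow>\<^sub>L real. \<psi> o\<^sub>L lip0_mult_blinfun f"
  have lin: "bounded_linear ?T"
    by (rule bounded_bilinear.bounded_linear_left[OF bounded_bilinear_blinfun_compose])
  have "?T (evaluation x) = (lip0_apply f x / dist x 0) *\<^sub>R evaluation x" for x
    by (rule blinfun_eqI) (simp add: lip0_mult_blinfun.rep_eq blinfun.scaleR_left)
  then have "?T (evaluation x) \<in> ?V" for x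
    by (simp add: span_base span_scale)
  then have "?T ` range evaluation \<subseteq> ?V"
    by auto
  then have "span (?T ` range evaluation) \<subseteq> ?V"
    by (rule span_minimal) simp
  then have "?T ` ?V \<subseteq> ?V"
    using linear_span_image[OF bounded_linear.linear[OF lin]] by metis
  then have "?T ` closure ?V \<subseteq> closure ?V"
    by (intro image_closure_subset linear_continuous_on[OF lin])
      (auto intro: subsetD[OF closure_subset])
  then show "\<phi> \<in> closure ?V \<Longrightarrow> ?T \<phi> \<in> closure ?V"
    by blast
qed

lemma lipfree_mult_apply [simp]:
  "functional_of (lipfree_mult f m) g = functional_of m (lip0_mult f g)"
  by (simp add: lipfree_mult.rep_eq lip0_mult_blinfun.rep_eq)

lemma lip0_mult_base_dist [simp]: "lip0_mult f base_dist = f"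
  by (rule lip0_eqI) (auto simp: lip0_apply_zero_point)

text \<open>For an evaluation this is \<open>conv\<close>, hence it holds on their span; the norm
  bound carries it to the closure by an \<epsilon>/3 argument. It relies on \<open>m\<close> lying
  in the free space and not just in the bidual.\<close>

lemma functional_of_tendsto:
  assumes bound: "\<And>k. norm (f k) \<le> C"
    and conv: "\<And>x. (\<lambda>k. lip0_apply (f k) x) \<longlonglongrightarrow> lip0_apply g x"
  shows "(\<lambda>k. functional_of m (f k)) \<longlonglongrightarrow> functional_of m g"
proof -
  let ?S = "{\<phi> :: 'a lip0 \<Rightarrow>\<^sub>L real. (\<lambda>k. \<phi> (f k)) \<longlonglongrightarrow> \<phi> g}"
  have "subspace ?S"
    by (rule subspaceI)
      (auto simp: blinfun.add_left blinfun.scaleR_left blinfun.zero_left intro: tendsto_intros)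
  then have span: "span (range evaluation) \<subseteq> ?S"
    by (intro span_minimal) (auto simp: conv)
  show ?thesis
  proof (rule LIMSEQ_I)
    fix e :: real assume e: "0 < e"
    \<comment> \<open>A common bound for the norms of all \<open>f k\<close> and of
      \<open>g\<close>, kept positive so that \<open>e / (3 * K)\<close> is a valid
      tolerance.\<close>
    define K where "K = \<bar>C\<bar> + norm g + 1"
    have K: "0 < K" by (simp add: K_def add_nonneg_pos)
    obtain \<psi> where \<psi>: "\<psi> \<in> span (range evaluation)" "dist \<psi> (functional_of m) < e / (3 * K)"
      using functional_of[of m] divide_pos_pos[of e "3 * K"] e K unfolding closure_approachable
      by (meson mult_pos_pos zero_less_numeral)
    have small: "\<bar>functional_of m h - \<psi> h\<bar> \<le> e / 3" if "norm h \<le> K" for h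
    proof -
      have "\<bar>(functional_of m - \<psi>) h\<bar> \<le> norm (functional_of m - \<psi>) * norm h"
        using norm_blinfun[of "functional_of m - \<psi>" h] by simp
      also have "\<dots> \<le> e / (3 * K) * K"
        using \<psi>(2) that e K by (intro mult_mono) (auto simp: dist_norm norm_minus_commute)
      finally show ?thesis using K by (simp add: blinfun.diff_left)
    qed
    obtain N where N: "\<And>k. k \<ge> N \<Longrightarrow> \<bar>\<psi> (f k) - \<psi> g\<bar> < e / 3"
      using span \<psi>(1) LIMSEQ_D[of "\<lambda>k. \<psi> (f k)" "\<psi> g" "e / 3"] e by auto
    have "norm (functional_of m (f k) - functional_of m g) < e" if "k \<ge> N" for k
    proof -
      have "norm (f k) \<le> K" "norm g \<le> K"
        using bound[of k] norm_ge_zero[of g] unfolding K_def by linarith+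
      from small[OF this(1)] small[OF this(2)] N[OF that] show ?thesis
        unfolding real_norm_def by linarith
    qed
    then show "\<exists>N. \<forall>k\<ge>N. norm (functional_of m (f k) - functional_of m g) < e"
      by blast
  qed
qed

lemma span_evaluation_finite_support:
  assumes "\<psi> \<in> span (range evaluation)"
  shows "\<exists>F. finite F \<and> (\<forall>f. (\<forall>x\<in>F. lip0_apply f x = 0) \<longrightarrow> blinfun_apply \<psi> f = 0)"
  using assms
proof (induction rule: span_induct_alt)
  case base
  then show ?case by (auto simp: blinfun.zero_left)
next
  case (step c \<phi> \<psi>)
  then obtain F x where F: "finite F" "\<And>f. (\<forall>x\<in>F. lip0_apply f x = 0) \<Longrightarrow> \<psi> f = 0" "\<phi> = evaluation x"
    by blast
  then show ?case
    by (intro exI[of _ "insert x F"]) (auto simp: blinfun.add_left blinfun.scaleR_left)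
qed

section \<open>Multiplicativity of nonzero extreme points\<close>

text \<open>If the norm \<open>l\<close> were strictly between 0 and 1, then \<open>m\<close> would
  lie inside the segment from 0 to \<open>m / l\<close>.\<close>

lemma extreme_point_norm_1:
  assumes m: "m extreme_point_of positive_unit_ball" "m \<noteq> 0"
  shows "functional_of m base_dist = 1"
proof (rule ccontr)
  let ?l = "functional_of m base_dist"
  assume "?l \<noteq> 1"
  moreover have pos: "positive_functional (functional_of m)" and "?l \<le> 1"
    using m(1) by (auto simp: extreme_point_of_def mem_positive_unit_ball_iff)
  moreover have "?l \<noteq> 0" using lipfree_eq_0_iff[OF pos] m(2) by simp
  moreover have "?l \<ge> 0" using pos by (simp add: positive_functional_def)
  ultimately have l: "0 < ?l" "?l < 1" by auto
  have "m /\<^sub>R ?l \<in> positive_unit_ball" "0 \<in> (positive_unit_ball :: 'a lipfree set)"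
    using pos l by (auto simp: mem_positive_unit_ball_iff positive_functional_def
        blinfun.scaleR_left blinfun.zero_left)
  moreover have "m \<in> open_segment 0 (m /\<^sub>R ?l)"
    unfolding in_segment using l m(2) by (intro conjI exI[of _ ?l]) auto
  ultimately show False using m(1) by (auto simp: extreme_point_of_def)
qed

text \<open>The parts \<open>n\<close> (\<open>u\<close> times \<open>m\<close>) and
  \<open>m - n\<close> are positive with norms \<open>l\<close> and \<open>1 - l\<close>, where
  \<open>l\<close> is the value of \<open>m\<close> at \<open>u\<close>. Normalizing them writes
  \<open>m\<close> as a convex combination, so extremality gives \<open>n = l m\<close>.\<close>

lemma extreme_point_multiplicative:
  assumes m: "m extreme_point_of positive_unit_ball" "m \<noteq> 0"
    and u: "\<And>x. 0 \<le> lip0_apply u x" "\<And>x. lip0_apply u x \<le> dist x 0"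
  shows "functional_of m (lip0_mult u f) = functional_of m u * functional_of m f"
proof -
  let ?\<phi> = "functional_of m" and ?l = "functional_of m u"
  define n where "n = lipfree_mult u m"
  have pos: "positive_functional ?\<phi>" and one: "?\<phi> base_dist = 1"
    using m extreme_point_norm_1[OF m] by (auto simp: extreme_point_of_def mem_positive_unit_ball_iff)
  have n_pos: "positive_functional (functional_of n)"
    using pos u(1) by (simp add: positive_functional_def n_def)
  have mn_pos: "positive_functional (functional_of (m - n))"
  proof -
    have "?\<phi> (lip0_mult u f) \<le> ?\<phi> f" if "\<And>x. 0 \<le> lip0_apply f x" for f
    proof (rule positive_functional_mono[OF pos])
      fix x
      show "lip0_apply (lip0_mult u f) x \<le> lip0_apply f x"
        using mult_right_mono[OF u(2)[of x] that[of x]]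
        by (cases "x = 0") (auto simp: lip0_apply_zero_point divide_le_eq mult.commute)
    qed
    then show ?thesis
      by (auto simp: positive_functional_def n_def blinfun.diff_left)
  qed
  have n_norm: "functional_of n base_dist = ?l" and mn_norm: "functional_of (m - n) base_dist = 1 - ?l"
    by (simp_all add: n_def one blinfun.diff_left)
  have "0 \<le> ?l" "?l \<le> 1"
    using n_pos mn_pos n_norm mn_norm by (auto simp: positive_functional_def dest!: spec[of _ base_dist])
  \<comment> \<open>For the weights 0 and 1 one part cannot be normalized, but it has norm 0 and
    therefore vanishes.\<close>
  then consider "?l = 0" | "?l = 1" | "0 < ?l" "?l < 1" by linarith
  then have "n = ?l *\<^sub>R m"
  proof cases
    case 1
    then show ?thesis using lipfree_eq_0_iff[OF n_pos] n_norm by simp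
  next
    case 2
    then show ?thesis using lipfree_eq_0_iff[OF mn_pos] mn_norm by simp
  next
    case 3
    let ?a = "(m - n) /\<^sub>R (1 - ?l)" and ?b = "n /\<^sub>R ?l"
    have "?a \<in> positive_unit_ball" "?b \<in> positive_unit_ball"
      using n_pos mn_pos n_norm mn_norm 3
      by (auto simp: mem_positive_unit_ball_iff positive_functional_def blinfun.scaleR_left)
    then have "m \<notin> open_segment ?a ?b"
      using m(1) by (auto simp: extreme_point_of_def)
    moreover have conv: "m = (1 - ?l) *\<^sub>R ?a + ?l *\<^sub>R ?b"
      using 3 by simp
    ultimately have "?a = ?b"
      unfolding in_segment using 3 by blast
    with conv have "m = ?b"
      by (metis scaleR_collapse)
    then have "?l *\<^sub>R m = ?l *\<^sub>R ?b" by simp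
    then show ?thesis using 3 by simp
  qed
  then have "functional_of n f = ?l * ?\<phi> f"
    by (simp add: blinfun.scaleR_left)
  then show ?thesis by (simp add: n_def)
qed

text \<open>Scaled below \<open>base_dist\<close>, \<open>u\<close> falls under multiplicativity,
  and its product with \<open>f\<close> is 0.\<close>

lemma extreme_point_disjoint:
  assumes m: "m extreme_point_of positive_unit_ball" "m \<noteq> 0"
    and u: "\<And>x. 0 \<le> lip0_apply u x" and uf: "\<And>x. lip0_apply u x * lip0_apply f x = 0"
  shows "functional_of m u = 0 \<or> functional_of m f = 0"
proof -
  define K where "K = norm u + 1"
  have K: "0 < K" by (simp add: K_def add_nonneg_pos)
  have le: "lip0_apply u x / K \<le> dist x 0" for x
    using abs_lip0_apply_le[of u x] K u[of x]
    by (simp add: K_def divide_le_eq algebra_simps add_increasing)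
  have "lip0_mult (u /\<^sub>R K) f = 0"
    by (rule lip0_eqI) (simp add: uf mult.assoc)
  moreover have "functional_of m (lip0_mult (u /\<^sub>R K) f) = functional_of m (u /\<^sub>R K) * functional_of m f"
    using u le K by (intro extreme_point_multiplicative[OF m]) (auto simp: divide_inverse mult.commute)
  ultimately show ?thesis
    using K by (simp add: blinfun.scaleR_right blinfun.zero_right)
qed

text \<open>At each point one of \<open>f - min f g\<close> and \<open>g - min f g\<close> is 0, and
  both are nonnegative, so \<open>m\<close> vanishes at one of them.\<close>

lemma extreme_point_min:
  assumes m: "m extreme_point_of positive_unit_ball" "m \<noteq> 0"
  shows "functional_of m (lip0_min f g) = functional_of m f
    \<or> functional_of m (lip0_min f g) = functional_of m g"
  using extreme_point_disjoint[OF m, of "f - lip0_min f g" "g - lip0_min f g"]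
  by (auto simp: blinfun.diff_right min_def)

section \<open>Concentration of an extreme point at a single point\<close>

lemma extreme_point_near_point:
  assumes m: "m extreme_point_of positive_unit_ball" "m \<noteq> 0" and e: "0 < e"
  shows "\<exists>x. functional_of m (point_dist x) < e"
proof -
  obtain \<psi> where \<psi>: "\<psi> \<in> span (range evaluation)" "dist \<psi> (functional_of m) < e"
    using functional_of[of m] e unfolding closure_approachable by blast
  obtain F where F: "finite F" "\<And>f. (\<forall>x\<in>F. lip0_apply f x = 0) \<Longrightarrow> \<psi> f = 0"
    using span_evaluation_finite_support[OF \<psi>(1)] by blast
  \<comment> \<open>\<open>g\<close> is the minimum of \<open>base_dist\<close> and the
    \<open>point_dist y\<close> for \<open>y\<close> in \<open>F\<close>; each new minimum keeps one
    of the two old values of \<open>m\<close>. Nonnegativity of \<open>g\<close> ensures that the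
    minimum vanishes at the added point.\<close>
  have "\<exists>g x. norm g \<le> 1 \<and> (\<forall>y\<in>F. lip0_apply g y = 0) \<and> (\<forall>y. 0 \<le> lip0_apply g y)
      \<and> functional_of m g = functional_of m (point_dist x)"
    using F(1)
  proof induction
    case empty
    show ?case
      by (rule exI[of _ "point_dist 0"]) (auto simp: norm_point_dist_le)
  next
    case (insert z F)
    then obtain g x where g: "norm g \<le> 1" "\<forall>y\<in>F. lip0_apply g y = 0" "\<forall>y. 0 \<le> lip0_apply g y"
      "functional_of m g = functional_of m (point_dist x)"
      by blast
    have "norm (lip0_min g (point_dist z)) \<le> 1"
      using norm_lip0_min_le[of g "point_dist z"] norm_point_dist_le[of z] g(1) by linarith
    moreover have "\<exists>x. functional_of m (lip0_min g (point_dist z)) = functional_of m (point_dist x)"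
      using extreme_point_min[OF m, of g "point_dist z"] g(4) by metis
    ultimately show ?case
      using g(2,3) by (intro exI[of _ "lip0_min g (point_dist z)"]) (auto simp: min_absorb2)
  qed
  then obtain g x where g: "norm g \<le> 1" "\<forall>y\<in>F. lip0_apply g y = 0"
    "functional_of m g = functional_of m (point_dist x)"
    by blast
  have "functional_of m g = (functional_of m - \<psi>) g"
    using F(2) g(2) by (simp add: blinfun.diff_left)
  also have "\<dots> \<le> norm (functional_of m - \<psi>) * norm g"
    using norm_blinfun[of "functional_of m - \<psi>" g] by simp
  also have "\<dots> \<le> norm (functional_of m - \<psi>) * 1"
    using g(1) by (intro mult_left_mono) auto
  also have "\<dots> < e"
    using \<psi>(2) by (simp add: dist_norm norm_minus_commute)
  finally show ?thesis using g(3) by auto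
qed

text \<open>All truncations are bounded by multiples of one another, so if \<open>m\<close> killed
  one it would kill all, and then also their bounded pointwise limit
  \<open>base_dist\<close>.\<close>

lemma functional_of_truncated_dist_pos:
  assumes pos: "positive_functional (functional_of m)" and m: "m \<noteq> 0" and t: "0 < t"
  shows "0 < functional_of m (truncated_dist t)"
proof (rule ccontr)
  assume "\<not> ?thesis"
  moreover have nonneg: "0 \<le> functional_of m (truncated_dist s)" for s
    using pos by (simp add: positive_functional_def)
  ultimately have zero: "functional_of m (truncated_dist t) = 0"
    by (metis not_less order_antisym)
  have "functional_of m (truncated_dist (real k)) = 0" for k
  proof (rule antisym[OF _ nonneg])
    have "functional_of m (truncated_dist (real k))
        \<le> functional_of m ((real k / t + 1) *\<^sub>R truncated_dist t)"
    proof (rule positive_functional_mono[OF pos])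
      fix x :: 'a
      \<comment> \<open>The summand \<open>k / t\<close> covers the case \<open>t \<le> r\<close>,
        the summand 1 the case \<open>r < t\<close>.\<close>
      have "min (real k) r \<le> (real k / t + 1) * min t r" if "0 \<le> r" for r
      proof (cases "t \<le> r")
        case True
        then show ?thesis
          using t mult_left_mono[of r "real k" t] by (auto simp: min_def field_simps add_increasing)
      next
        case False
        then show ?thesis using t that by (auto simp: min_def algebra_simps add_increasing2)
      qed
      then show "lip0_apply (truncated_dist (real k)) x \<le> lip0_apply ((real k / t + 1) *\<^sub>R truncated_dist t) x"
        using t by simp
    qed
    then show "functional_of m (truncated_dist (real k)) \<le> 0"
      by (simp add: blinfun.scaleR_right zero)
  qed
  moreover have "(\<lambda>k. functional_of m (truncated_dist (real k))) \<longlonglongrightarrow> functional_of m base_dist"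
  proof (rule functional_of_tendsto[OF norm_truncated_dist_le])
    fix x :: 'a
    obtain N where N: "dist x 0 \<le> real N" using real_arch_simple by blast
    then have "\<forall>\<^sub>F k in sequentially. lip0_apply (truncated_dist (real k)) x = lip0_apply base_dist x"
      by (intro eventually_sequentiallyI[of N]) simp
    then show "(\<lambda>k. lip0_apply (truncated_dist (real k)) x) \<longlonglongrightarrow> lip0_apply base_dist x"
      by (rule tendsto_eventually)
  qed
  ultimately have "functional_of m base_dist = 0"
    by (simp add: LIMSEQ_const_iff)
  then show False using lipfree_eq_0_iff[OF pos] m by simp
qed

text \<open>Completeness of the space enters here, to turn the Cauchy sequence of almost optimal
  points into an actual point.\<close>

lemma extreme_point_concentrated:
  fixes m :: "'a :: {complete_space, zero} lipfree"
  assumes m: "m extreme_point_of positive_unit_ball" "m \<noteq> 0"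
  shows "\<exists>x. functional_of m (point_dist x) = 0"
proof -
  have pos: "positive_functional (functional_of m)"
    using m by (auto simp: extreme_point_of_def mem_positive_unit_ball_iff)
  have min_add_le: "min s c \<le> min a c + min b c"
    if "s \<le> a + b" "0 \<le> a" "0 \<le> b" "0 \<le> c" for s a b c :: real
    using that by (auto simp: min_def)
  have "\<forall>n. \<exists>x. functional_of m (point_dist x) < inverse (real (Suc n))"
    using extreme_point_near_point[OF m] by simp
  then obtain x where x: "\<And>n. functional_of m (point_dist (x n)) < inverse (real (Suc n))"
    by metis
  have lim0: "(\<lambda>n. functional_of m (point_dist (x n))) \<longlonglongrightarrow> 0"
  proof (rule tendsto_sandwich[OF _ _ tendsto_const LIMSEQ_inverse_real_of_nat])
    show "\<forall>\<^sub>F n in sequentially. 0 \<le> functional_of m (point_dist (x n))"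
      using pos by (simp add: positive_functional_def)
    show "\<forall>\<^sub>F n in sequentially. functional_of m (point_dist (x n)) \<le> inverse (real (Suc n))"
      using x by (simp add: less_imp_le)
  qed
  have "Cauchy x"
  proof (rule metric_CauchyI)
    fix t :: real assume t: "0 < t"
    \<comment> \<open>Two points at distance at least \<open>t\<close> cannot both have values below
      half, since the sum of their \<open>point_dist\<close> dominates
      \<open>truncated_dist t\<close>.\<close>
    have "0 < functional_of m (truncated_dist t) / 2"
      using functional_of_truncated_dist_pos[OF pos m(2) t] by simp
    then obtain N where N: "\<And>n. n \<ge> N \<Longrightarrow>
        functional_of m (point_dist (x n)) < functional_of m (truncated_dist t) / 2"
      using order_tendstoD(2)[OF lim0] unfolding eventually_sequentially by blast
    have "dist (x i) (x j) < t" if "i \<ge> N" "j \<ge> N" for i j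
    proof (rule ccontr)
      assume "\<not> dist (x i) (x j) < t"
      then have far: "t \<le> dist (x i) (x j)" by simp
      have "functional_of m (truncated_dist t)
          \<le> functional_of m (point_dist (x i) + point_dist (x j))"
      proof (rule positive_functional_mono[OF pos])
        fix y
        show "lip0_apply (truncated_dist t) y \<le> lip0_apply (point_dist (x i) + point_dist (x j)) y"
          using min_add_le[of t "dist (x i) y" "dist (x j) y" "dist y 0"]
            far dist_triangle2[of "x i" "x j" y] t
          by simp
      qed
      with N[OF that(1)] N[OF that(2)] show False
        by (simp add: blinfun.add_right)
    qed
    then show "\<exists>N. \<forall>i\<ge>N. \<forall>j\<ge>N. dist (x i) (x j) < t" by blast
  qed
  then obtain z where z: "x \<longlonglongrightarrow> z"
    by (auto simp: Cauchy_convergent_iff convergent_def)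
  \<comment> \<open>The functions \<open>point_dist (x n)\<close> converge pointwise and share the
    norm bound 1, which suffices for an element of the free space.\<close>
  have "(\<lambda>n. functional_of m (point_dist (x n))) \<longlonglongrightarrow> functional_of m (point_dist z)"
    by (rule functional_of_tendsto[OF norm_point_dist_le]) (auto intro!: tendsto_intros z)
  then have "functional_of m (point_dist z) = 0"
    using LIMSEQ_unique lim0 by blast
  then show ?thesis ..
qed

text \<open>Subtracting a multiple of \<open>base_dist\<close> from \<open>f\<close> yields a
  function \<open>g\<close> with \<open>g x = 0\<close>; then \<open>\<bar>g\<bar>\<close> is at
  most a multiple of \<open>point_dist x\<close>, so \<open>m\<close> kills \<open>g\<close>. The
  point is not 0 because \<open>point_dist 0 = base_dist\<close>.\<close>

lemma concentrated_eq_delta: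
  assumes pos: "positive_functional (functional_of m)" and one: "functional_of m base_dist = 1"
    and x: "functional_of m (point_dist x) = 0"
  shows "x \<noteq> 0" "m = delta x /\<^sub>R dist x 0"
proof -
  show "x \<noteq> 0"
    using one x by (auto simp: point_dist_zero)
  show "m = delta x /\<^sub>R dist x 0"
  proof (rule lipfree_eqI)
    fix f
    let ?c = "lip0_apply f x / dist x 0"
    let ?g = "f - ?c *\<^sub>R base_dist"
    have gx: "lip0_apply ?g x = 0" using \<open>x \<noteq> 0\<close> by simp
    have "\<bar>functional_of m ?g\<bar> \<le> functional_of m (norm ?g *\<^sub>R point_dist x)"
    proof (rule positive_functional_abs_le[OF pos])
      fix y
      have "\<bar>lip0_apply ?g y\<bar> \<le> norm ?g * dist x y"
        using lipschitz_onD[OF lip0_apply_lipschitz, of y x ?g] gx by (simp add: dist_commute)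
      then show "\<bar>lip0_apply ?g y\<bar> \<le> lip0_apply (norm ?g *\<^sub>R point_dist x) y"
        using abs_lip0_apply_le[of ?g y] by (auto simp: min_def)
    qed
    then have "functional_of m ?g = 0"
      by (simp add: blinfun.scaleR_right x)
    then show "functional_of m f = functional_of (delta x /\<^sub>R dist x 0) f"
      by (simp add: blinfun.diff_right blinfun.scaleR_right blinfun.scaleR_left one
          divide_inverse mult.commute)
  qed
qed

section \<open>The dual of the free space as a space of Lipschitz functions\<close>

lift_definition lipfree_dual :: "'a :: {metric_space, zero} lip0 \<Rightarrow> 'a lipfree \<Rightarrow>\<^sub>L real"
  is "\<lambda>f m. functional_of m f"
proof (rule bounded_linear_intro)
  show "norm (functional_of m f) \<le> norm m * norm f" for m and f :: "'a lip0"
    using norm_blinfun[of "functional_of m" f] by (simp add: norm_lipfree.rep_eq)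
qed (simp_all add: blinfun.add_left blinfun.scaleR_left)

declare lipfree_dual.rep_eq [simp]

lemma lipfree_dual_simps:
  "lipfree_dual (f + g) = lipfree_dual f + lipfree_dual g"
  "lipfree_dual (f - g) = lipfree_dual f - lipfree_dual g"
  "lipfree_dual (r *\<^sub>R f) = r *\<^sub>R lipfree_dual f"
  by (auto intro!: blinfun_eqI simp: blinfun.add_left blinfun.scaleR_left blinfun.diff_left
      blinfun.add_right blinfun.scaleR_right blinfun.diff_right)

lemma norm_delta_diff_le: "norm (delta x - delta y) \<le> dist x y"
proof -
  have "norm (functional_of (delta x - delta y)) \<le> dist x y"
  proof (rule norm_blinfun_bound)
    show "norm (functional_of (delta x - delta y) f) \<le> dist x y * norm f" for f
      using lipschitz_onD[OF lip0_apply_lipschitz, of x y f]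
      by (simp add: blinfun.diff_left dist_real_def mult.commute)
  qed simp
  then show ?thesis by (simp add: norm_lipfree.rep_eq)
qed

text \<open>The embedding into the dual of \<open>lip0\<close> is linear and isometric, so density
  of the span of evaluations can be pulled back.\<close>

lemma lipfree_in_closure_span_delta: "m \<in> closure (span (range delta))"
proof -
  have span: "\<exists>n\<in>span (range delta). functional_of n = \<psi>" if "\<psi> \<in> span (range evaluation)" for \<psi>
    using that
  proof (induction rule: span_induct_alt)
    case base
    then show ?case by (intro bexI[of _ 0]) (auto simp: span_zero)
  next
    case (step c \<phi> \<psi>)
    then obtain n x where "n \<in> span (range delta)" "functional_of n = \<psi>" "\<phi> = evaluation x"
      by blast
    then show ?case
      by (intro bexI[of _ "c *\<^sub>R delta x + n"]) (simp_all add: span_add span_scale span_base)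
  qed
  show ?thesis
    unfolding closure_approachable
  proof (intro allI impI)
    fix e :: real assume "0 < e"
    then obtain \<psi> where "\<psi> \<in> span (range evaluation)" "dist \<psi> (functional_of m) < e"
      using functional_of[of m] unfolding closure_approachable by blast
    with span obtain n where "n \<in> span (range delta)" "dist (functional_of n) (functional_of m) < e"
      by blast
    then show "\<exists>n\<in>span (range delta). dist n m < e"
      by (intro bexI[of _ n]) (auto simp: dist_norm norm_lipfree.rep_eq)
  qed
qed

text \<open>A functional \<psi> is represented by \<open>\<lambda>x. \<psi> (delta x)\<close>, which
  is Lipschitz since \<open>delta\<close> is nonexpansive; the two agree on a dense
  subspace.\<close>

lemma surj_lipfree_dual: "surj lipfree_dual"
proof -
  have "\<exists>f. \<psi> = lipfree_dual f" for \<psi> :: "'a lipfree \<Rightarrow>\<^sub>L real"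
  proof -
    have delta0: "delta (0 :: 'a) = 0"
      by (rule lipfree_eqI) (simp add: lip0_apply_zero_point blinfun.zero_left)
    have "(norm \<psi>)-lipschitz_on UNIV (\<lambda>x. \<psi> (delta x))"
    proof (rule lipschitz_onI)
      fix x y :: 'a
      have "dist (\<psi> (delta x)) (\<psi> (delta y)) \<le> norm \<psi> * norm (delta x - delta y)"
        using norm_blinfun[of \<psi> "delta x - delta y"] by (simp add: dist_norm blinfun.diff_right)
      also have "\<dots> \<le> norm \<psi> * dist x y"
        by (intro mult_left_mono norm_delta_diff_le) simp
      finally show "dist (\<psi> (delta x)) (\<psi> (delta y)) \<le> norm \<psi> * dist x y" .
    qed simp
    then obtain f where f: "lip0_apply f = (\<lambda>x. \<psi> (delta x))"
      using Lip0_inverse[of "\<lambda>x. \<psi> (delta x)"] delta0 by (auto simp: blinfun.zero_right)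
    let ?d = "\<psi> - lipfree_dual f"
    have "subspace {m. ?d m = 0}"
      by (rule subspaceI) (auto simp: blinfun.add_right blinfun.scaleR_right blinfun.zero_right)
    then have "span (range delta) \<subseteq> {m. ?d m = 0}"
      by (intro span_minimal) (auto simp: blinfun.diff_left f)
    moreover have "closed {m. ?d m = 0}"
      by (intro closed_Collect_eq continuous_intros)
    ultimately have "closure (span (range delta)) \<subseteq> {m. ?d m = 0}"
      by (rule closure_minimal)
    then have "?d m = 0" for m
      using lipfree_in_closure_span_delta by blast
    then have "\<psi> = lipfree_dual f"
      by (intro blinfun_eqI) (simp add: blinfun.diff_left)
    then show ?thesis ..
  qed
  then show ?thesis by (auto simp: surj_def)
qed

lemma lipfree_bidual_eqI:
  fixes \<Phi> \<Psi> :: "('a :: {metric_space, zero} lipfree \<Rightarrow>\<^sub>L real) \<Rightarrow>\<^sub>L real"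
  assumes "\<And>f. \<Phi> (lipfree_dual f) = \<Psi> (lipfree_dual f)"
  shows "\<Phi> = \<Psi>"
  by (rule blinfun_eqI) (metis assms surj_lipfree_dual surjD)

section \<open>Weak* closures in the bidual\<close>

abbreviation bidual_closure :: "'b :: real_normed_vector set \<Rightarrow> (('b \<Rightarrow>\<^sub>L real) \<Rightarrow>\<^sub>L real) set"
  where "bidual_closure C \<equiv> strong_operator_topology closure_of (bidual_embedding ` C)"

lemma bidual_embedding_in_closure: "x \<in> C \<Longrightarrow> bidual_embedding x \<in> bidual_closure C"
  by (rule subsetD[OF closure_of_subset]) (auto simp: strong_operator_topology_topspace)

text \<open>Evaluation at \<psi> is weak* continuous, so the half-space it defines is
  closed.\<close>

lemma bidual_closure_le:
  assumes "\<Phi> \<in> bidual_closure C" "\<And>x. x \<in> C \<Longrightarrow> blinfun_apply \<psi> x \<le> c"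
  shows "\<Phi> \<psi> \<le> c"
proof -
  have "closedin strong_operator_topology {\<Phi> \<in> topspace strong_operator_topology. blinfun_apply \<Phi> \<psi> \<in> {..c}}"
    by (rule closedin_continuous_map_preimage[OF strong_operator_topology_continuous_evaluation]) simp
  then have "bidual_closure C \<subseteq> {\<Phi> \<in> topspace strong_operator_topology. blinfun_apply \<Phi> \<psi> \<in> {..c}}"
    by (rule closure_of_minimal[rotated])
      (auto simp: strong_operator_topology_topspace bidual_embedding.rep_eq assms(2))
  then show ?thesis using assms(1) by auto
qed

lemma positive_unit_ball_bidual_closure:
  assumes \<Phi>: "\<Phi> \<in> bidual_closure positive_unit_ball"
  shows "(\<And>x. 0 \<le> lip0_apply f x) \<Longrightarrow> 0 \<le> \<Phi> (lipfree_dual f)"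
    and "\<Phi> (lipfree_dual base_dist) \<le> 1"
proof -
  assume f: "\<And>x. 0 \<le> lip0_apply f x"
  have "\<Phi> (- lipfree_dual f) \<le> 0"
    using f by (intro bidual_closure_le[OF \<Phi>])
      (auto simp: mem_positive_unit_ball_iff positive_functional_def blinfun.minus_left)
  then show "0 \<le> \<Phi> (lipfree_dual f)" by (simp add: blinfun.minus_right)
next
  show "\<Phi> (lipfree_dual base_dist) \<le> 1"
    by (intro bidual_closure_le[OF \<Phi>]) (auto simp: mem_positive_unit_ball_iff)
qed

lemma bidual_closure_abs_le:
  assumes \<Phi>: "\<Phi> \<in> bidual_closure positive_unit_ball"
    and fg: "\<And>x. \<bar>lip0_apply f x\<bar> \<le> lip0_apply g x"
  shows "\<bar>\<Phi> (lipfree_dual f)\<bar> \<le> \<Phi> (lipfree_dual g)"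
proof -
  have "0 \<le> lip0_apply (g - f) x" "0 \<le> lip0_apply (g + f) x" for x
    using fg[of x] by auto
  from this[THEN positive_unit_ball_bidual_closure(1)[OF \<Phi>]] show ?thesis
    by (simp add: lipfree_dual_simps blinfun.diff_right blinfun.add_right abs_le_iff)
qed

text \<open>The canonical embedding is linear and injective, so a proper segment through
  \<open>m\<close> maps to a proper segment through its image.\<close>

lemma preserved_extreme_point_imp_extreme_point:
  fixes m :: "'a :: {metric_space, zero} lipfree"
  assumes "m preserved_extreme_point_of C" "m \<in> C"
  shows "m extreme_point_of C"
  unfolding extreme_point_of_def
proof (intro conjI ballI notI)
  fix a b assume ab: "a \<in> C" "b \<in> C" and seg: "m \<in> open_segment a b"
  from seg obtain t where t: "a \<noteq> b" "0 < t" "t < 1" "m = (1 - t) *\<^sub>R a + t *\<^sub>R b"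
    unfolding in_segment by blast
  have "bidual_embedding a \<noteq> bidual_embedding b"
  proof
    assume eq: "bidual_embedding a = bidual_embedding b"
    have "a = b"
    proof (rule lipfree_eqI)
      show "functional_of a f = functional_of b f" for f
        using arg_cong[OF eq, of "\<lambda>\<Phi>. blinfun_apply \<Phi> (lipfree_dual f)"]
        by (simp add: bidual_embedding.rep_eq)
    qed
    with t(1) show False by simp
  qed
  moreover have "bidual_embedding m = (1 - t) *\<^sub>R bidual_embedding a + t *\<^sub>R bidual_embedding b"
    by (rule blinfun_eqI) (simp add: t(4) bidual_embedding.rep_eq blinfun.add_left
        blinfun.add_right blinfun.scaleR_left blinfun.scaleR_right)
  ultimately have "bidual_embedding m \<in> open_segment (bidual_embedding a) (bidual_embedding b)"
    unfolding in_segment using t by blast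
  then show False
    using assms(1) ab bidual_embedding_in_closure
    unfolding preserved_extreme_point_of_def extreme_point_of_def by blast
qed (rule assms(2))

section \<open>Preserved extremality of the normalized evaluations\<close>

text \<open>Two nonnegative values at \<open>\<bar>f\<bar>\<close> with a vanishing proper convex
  combination are both 0, and they bound the values at \<open>f\<close>.\<close>

lemma preserved_extreme_point_0:
  "(0 :: 'a :: {metric_space, zero} lipfree) preserved_extreme_point_of positive_unit_ball"
  unfolding preserved_extreme_point_of_def extreme_point_of_def
proof (intro conjI ballI notI)
  have "(0 :: 'a lipfree) \<in> positive_unit_ball"
    by (simp add: mem_positive_unit_ball_iff positive_functional_def blinfun.zero_left)
  then show "bidual_embedding (0 :: 'a lipfree) \<in> bidual_closure positive_unit_ball"
    by (rule bidual_embedding_in_closure)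
next
  fix \<Phi> \<Psi> :: "('a lipfree \<Rightarrow>\<^sub>L real) \<Rightarrow>\<^sub>L real"
  assume mem: "\<Phi> \<in> bidual_closure positive_unit_ball" "\<Psi> \<in> bidual_closure positive_unit_ball"
    and seg: "bidual_embedding 0 \<in> open_segment \<Phi> \<Psi>"
  from seg obtain t where t: "\<Phi> \<noteq> \<Psi>" "0 < t" "t < 1" "bidual_embedding 0 = (1 - t) *\<^sub>R \<Phi> + t *\<^sub>R \<Psi>"
    unfolding in_segment by blast
  have comb: "(1 - t) * \<Phi> (lipfree_dual f) + t * \<Psi> (lipfree_dual f) = 0" for f
    using arg_cong[OF t(4), of "\<lambda>\<Theta>. blinfun_apply \<Theta> (lipfree_dual f)"]
    by (simp add: bidual_embedding.rep_eq blinfun.add_left blinfun.scaleR_left blinfun.zero_left)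
  have pos: "0 \<le> \<Phi> (lipfree_dual (lip0_abs f))" "0 \<le> \<Psi> (lipfree_dual (lip0_abs f))" for f
    using mem by (auto intro: positive_unit_ball_bidual_closure)
  have "\<Phi> (lipfree_dual (lip0_abs f)) = 0 \<and> \<Psi> (lipfree_dual (lip0_abs f)) = 0" for f
    using comb[of "lip0_abs f"] pos[of f] t(2,3) by (simp add: add_nonneg_eq_0_iff)
  then have "\<Phi> (lipfree_dual f) = 0" "\<Psi> (lipfree_dual f) = 0" for f
    using bidual_closure_abs_le[OF mem(1), of f "lip0_abs f"]
      bidual_closure_abs_le[OF mem(2), of f "lip0_abs f"] by simp_all
  then have "\<Phi> = \<Psi>" by (intro lipfree_bidual_eqI) simp
  with t(1) show False by simp
qed

lemma delta_in_positive_unit_ball: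
  assumes "x \<noteq> 0"
  shows "delta x /\<^sub>R dist x 0 \<in> positive_unit_ball"
  using assms by (simp add: mem_positive_unit_ball_iff positive_functional_def blinfun.scaleR_left)

lemma preserved_extreme_point_delta:
  fixes x :: "'a :: {metric_space, zero}"
  assumes x: "x \<noteq> 0"
  shows "delta x /\<^sub>R dist x 0 preserved_extreme_point_of positive_unit_ball"
  unfolding preserved_extreme_point_of_def extreme_point_of_def
proof (intro conjI ballI notI)
  show "bidual_embedding (delta x /\<^sub>R dist x 0) \<in> bidual_closure positive_unit_ball"
    by (rule bidual_embedding_in_closure[OF delta_in_positive_unit_ball[OF x]])
next
  fix \<Phi> \<Psi> :: "('a lipfree \<Rightarrow>\<^sub>L real) \<Rightarrow>\<^sub>L real"
  assume mem: "\<Phi> \<in> bidual_closure positive_unit_ball" "\<Psi> \<in> bidual_closure positive_unit_ball"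
    and seg: "bidual_embedding (delta x /\<^sub>R dist x 0) \<in> open_segment \<Phi> \<Psi>"
  from seg obtain t where t: "\<Phi> \<noteq> \<Psi>" "0 < t" "t < 1"
    "bidual_embedding (delta x /\<^sub>R dist x 0) = (1 - t) *\<^sub>R \<Phi> + t *\<^sub>R \<Psi>"
    unfolding in_segment by blast
  have comb: "(1 - t) * \<Phi> (lipfree_dual f) + t * \<Psi> (lipfree_dual f) = lip0_apply f x / dist x 0" for f
    using arg_cong[OF t(4), of "\<lambda>\<Theta>. blinfun_apply \<Theta> (lipfree_dual f)"]
    by (simp add: bidual_embedding.rep_eq blinfun.add_left blinfun.scaleR_left divide_inverse mult.commute)
  have one: "\<Phi> (lipfree_dual base_dist) = 1" "\<Psi> (lipfree_dual base_dist) = 1"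
  proof -
    let ?a = "\<Phi> (lipfree_dual base_dist)" and ?b = "\<Psi> (lipfree_dual base_dist)"
    \<comment> \<open>Both values are at most 1 and their proper convex combination is 1, so neither
      defect can be positive.\<close>
    have "(1 - t) * (1 - ?a) + t * (1 - ?b) = 0"
      using comb[of base_dist] x by (simp add: algebra_simps)
    moreover have "0 \<le> 1 - ?a" "0 \<le> 1 - ?b"
      using mem by (auto intro: positive_unit_ball_bidual_closure)
    ultimately show "?a = 1" "?b = 1"
      using t(2,3) by (simp_all add: add_nonneg_eq_0_iff)
  qed
  have "\<Phi> (lipfree_dual f) = \<Psi> (lipfree_dual f)" for f
  proof -
    let ?c = "lip0_apply f x / dist x 0"
    \<comment> \<open>Chosen to vanish at \<open>x\<close>: the combination is then 0 at
      \<open>\<bar>?g\<bar>\<close>, and both functionals take the value \<open>?c\<close> at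
      \<open>f\<close>.\<close>
    let ?g = "f - ?c *\<^sub>R base_dist"
    have pos: "0 \<le> \<Phi> (lipfree_dual (lip0_abs ?g))" "0 \<le> \<Psi> (lipfree_dual (lip0_abs ?g))"
      using mem by (auto intro: positive_unit_ball_bidual_closure)
    have "\<Phi> (lipfree_dual (lip0_abs ?g)) = 0 \<and> \<Psi> (lipfree_dual (lip0_abs ?g)) = 0"
      using comb[of "lip0_abs ?g"] pos t(2,3) x by (simp add: add_nonneg_eq_0_iff)
    then have "\<Phi> (lipfree_dual ?g) = 0" "\<Psi> (lipfree_dual ?g) = 0"
      using bidual_closure_abs_le[OF mem(1), of ?g "lip0_abs ?g"]
        bidual_closure_abs_le[OF mem(2), of ?g "lip0_abs ?g"] by simp_all
    then show ?thesis
      by (simp add: lipfree_dual_simps blinfun.diff_right blinfun.scaleR_right one)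
  qed
  then have "\<Phi> = \<Psi>" by (rule lipfree_bidual_eqI)
  with t(1) show False by simp
qed

theorem theorem3p8:
  shows "{m :: 'a :: {complete_space, zero} lipfree. m extreme_point_of positive_unit_ball}
      = {0} \<union> {delta x /\<^sub>R dist x 0 | x. x \<noteq> 0}
    \<and> (\<forall>m :: 'a lipfree. m extreme_point_of positive_unit_ball
          \<longrightarrow> m preserved_extreme_point_of positive_unit_ball)"
proof -
  let ?E = "{0} \<union> {delta x /\<^sub>R dist x 0 | x :: 'a. x \<noteq> 0}"
  have sub: "m \<in> ?E" if m: "m extreme_point_of positive_unit_ball" for m :: "'a lipfree"
  proof (cases "m = 0")
    case False
    obtain x where "functional_of m (point_dist x) = 0"
      using extreme_point_concentrated[OF m False] by blast
    moreover have "positive_functional (functional_of m)"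
      using m by (simp add: extreme_point_of_def mem_positive_unit_ball_iff)
    ultimately show ?thesis
      using concentrated_eq_delta[of m x] extreme_point_norm_1[OF m False] by blast
  qed simp
  have preserved: "m preserved_extreme_point_of positive_unit_ball" if "m \<in> ?E" for m
    using that by (auto intro: preserved_extreme_point_0 preserved_extreme_point_delta)
  \<comment> \<open>Extremality in the ball itself is inherited from extremality in its weak*
    closure.\<close>
  have "m extreme_point_of positive_unit_ball" if "m \<in> ?E" for m
  proof (rule preserved_extreme_point_imp_extreme_point[OF preserved[OF that]])
    have "(0 :: 'a lipfree) \<in> positive_unit_ball"
      by (simp add: mem_positive_unit_ball_iff positive_functional_def blinfun.zero_left)
    then show "m \<in> positive_unit_ball"
      using that delta_in_positive_unit_ball by blast
  qed
  then have "{m. m extreme_point_of positive_unit_ball} = ?E"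
    using sub by (intro equalityI subsetI CollectI) (simp_all only: mem_Collect_eq)
  then show ?thesis
    using preserved sub by (intro conjI allI impI) simp_all
qed

end
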